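(* Let $x=P(x)$ be a max/minPPS in simple normal form with least fixed point $q^*$. Let $q\in\mathbb R^n$ with $0\le q\le q^*$ and $q<\mathbf 1$, and let $\sigma$ be a policy with $P(q)=P_\sigma(q)$ and $\rho\big(P'_\sigma(\tfrac12(q^*+q^*_\sigma))\big)<1$ (so that $(I-P'_\sigma(\tfrac12(q^*+q^*_\sigma)))^{-1}$ exists and is non-negative). Then $$\|q^*_\sigma-q^*\|_\infty\le\Big(2\big\|(I-P'_\sigma(\tfrac12(q^*_\sigma+q^* )))^{-1}\big\|_\infty+1\Big)\,\|q^*-q\|_\infty.$$
   Context: A maxPPS (minPPS) is a system $x_i=P_i(x)$, $i=1,\dots,n$, each $P_i$ the maximum (minimum) of finitely many probabilistic polynomials $q_{i,1},\dots,q_{i,m_i}$ (polynomials with rational nonnegative coefficients summing to at most $1$). Simple normal form: each $P_i$ is (L) $a_{i,0}+\sum_ja_{i,j}x_j$ with $a_{i,j}\ge0$, $\sum_{j\ge0}a_{i,j}\le1$; (Q) $x_jx_k$; or (M) $\max\{x_j,x_k\}$ (for a minPPS, $\min\{x_j,x_k\}$). $q^*$ is the least fixed point in $[0,1]^n$. A policy $\sigma$ picks $\sigma(i)\in\{1,\dots,m_i\}$ for each $i$ (for form M, one of the two variables); $P_\sigma$ is the resulting polynomial system with $(P_\sigma)_i=q_{i,\sigma(i)}$ and $q^*_\sigma$ its least fixed point. $P'_\sigma(x)$ is the Jacobian matrix of $P_\sigma$ at $x$, $\rho(A)$ the spectral radius, $\|A\|_\infty=\max_i\sum_j|A_{ij}|$,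 $\mathbf 1$ the all-ones vector. *)

theory Defs
  imports "HOL-Analysis.Analysis" "HOL-Library.Poly_Mapping"
begin

section \<open>Probabilistic polynomials\<close>

text \<open>Formal polynomials over the rationals in variables indexed by the finite type \<open>'n\<close>:
  finitely supported maps from monomials (exponent vectors) to coefficients. Addition and
  multiplication of these are the ring operations of \<open>HOL-Library.Poly_Mapping\<close>.\<close>

type_synonym 'n mpoly = "('n \<Rightarrow>\<^sub>0 nat) \<Rightarrow>\<^sub>0 rat"

definition Const :: "rat \<Rightarrow> 'n mpoly" where
  "Const a = Poly_Mapping.single 0 a"

definition Var :: "'n \<Rightarrow> 'n mpoly" where
  "Var j = Poly_Mapping.single (Poly_Mapping.single j 1) 1"

definition eval_poly :: "'n::finite mpoly \<Rightarrow> real^'n \<Rightarrow> real" where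
  "eval_poly p x =
     (\<Sum>m\<in>Poly_Mapping.keys p.
        of_rat (Poly_Mapping.lookup p m) * (\<Prod>j\<in>UNIV. (x $ j) ^ Poly_Mapping.lookup m j))"

definition probabilistic_poly :: "'n mpoly \<Rightarrow> bool" where
  "probabilistic_poly p \<longleftrightarrow>
     (\<forall>m. 0 \<le> Poly_Mapping.lookup p m) \<and>
     (\<Sum>m\<in>Poly_Mapping.keys p. Poly_Mapping.lookup p m) \<le> 1"


section \<open>Max/min probabilistic polynomial systems\<close>

datatype objective = Maximize | Minimize

text \<open>A system lists, for every variable \<open>i\<close>, the polynomials whose maximum (minimum) is
  the right-hand side of the equation for \<open>i\<close>.\<close>

type_synonym 'n pps = "'n \<Rightarrow> 'n mpoly list"

definition is_pps :: "'n pps \<Rightarrow> bool" where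
  "is_pps Q \<longleftrightarrow> (\<forall>i. Q i \<noteq> [] \<and> (\<forall>p\<in>set (Q i). probabilistic_poly p))"

fun extremum :: "objective \<Rightarrow> real set \<Rightarrow> real" where
  "extremum Maximize S = Max S"
| "extremum Minimize S = Min S"

definition pps_map :: "objective \<Rightarrow> 'n::finite pps \<Rightarrow> real^'n \<Rightarrow> real^'n" where
  "pps_map opt Q x = (\<chi> i. extremum opt ((\<lambda>p. eval_poly p x) ` set (Q i)))"

text \<open>The polynomials for \<open>i\<close> are numbered from 0, so a policy selects an index
  below \<open>length (Q i)\<close>.\<close>

definition is_policy :: "'n pps \<Rightarrow> ('n \<Rightarrow> nat) \<Rightarrow> bool" where
  "is_policy Q \<sigma> \<longleftrightarrow> (\<forall>i. \<sigma> i < length (Q i))"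

definition policy_map :: "'n::finite pps \<Rightarrow> ('n \<Rightarrow> nat) \<Rightarrow> real^'n \<Rightarrow> real^'n" where
  "policy_map Q \<sigma> x = (\<chi> i. eval_poly (Q i ! \<sigma> i) x)"

definition form_L :: "'n::finite mpoly list \<Rightarrow> bool" where
  "form_L ps \<longleftrightarrow>
     (\<exists>a0 a. 0 \<le> a0 \<and> (\<forall>j. 0 \<le> a j) \<and> a0 + (\<Sum>j\<in>UNIV. a j) \<le> 1 \<and>
        ps = [Const a0 + (\<Sum>j\<in>UNIV. Const (a j) * Var j)])"

definition form_Q :: "'n mpoly list \<Rightarrow> bool" where
  "form_Q ps \<longleftrightarrow> (\<exists>j k. ps = [Var j * Var k])"

definition form_M :: "'n mpoly list \<Rightarrow> bool" where
  "form_M ps \<longleftrightarrow> (\<exists>j k. ps = [Var j, Var k])"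

definition simple_normal_form :: "'n::finite pps \<Rightarrow> bool" where
  "simple_normal_form Q \<longleftrightarrow> (\<forall>i. form_L (Q i) \<or> form_Q (Q i) \<or> form_M (Q i))"


section \<open>Least fixed points in the unit cube\<close>

text \<open>The order on \<open>real^'n\<close> is componentwise, so \<open>{0..1}\<close> is the unit cube.\<close>

definition is_least_fp :: "(real^'n \<Rightarrow> real^'n) \<Rightarrow> real^'n \<Rightarrow> bool" where
  "is_least_fp F x \<longleftrightarrow> x \<in> {0..1} \<and> F x = x \<and> (\<forall>y\<in>{0..1}. F y = y \<longrightarrow> x \<le> y)"

definition least_fp :: "(real^'n \<Rightarrow> real^'n) \<Rightarrow> real^'n" where
  "least_fp F = (THE x. is_least_fp F x)"


section \<open>Spectral radius and matrix norm\<close>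

definition eigenvalues :: "real^'n^'n \<Rightarrow> complex set" where
  "eigenvalues A =
     {l. \<exists>v::complex^'n. v \<noteq> 0 \<and> (\<chi> i j. complex_of_real (A $ i $ j)) *v v = l *s v}"

definition spectral_radius :: "real^'n^'n \<Rightarrow> real" where
  "spectral_radius A = Max (cmod ` eigenvalues A)"

definition mat_infnorm :: "real^'n^'m \<Rightarrow> real" where
  "mat_infnorm A = Max (range (\<lambda>i. \<Sum>j\<in>UNIV. \<bar>A $ i $ j\<bar>))"


section \<open>Well-definedness\<close>

lemma least_fp_eqI:
  assumes "is_least_fp F x"
  shows "least_fp F = x"
  unfolding least_fp_def
  using assms by (intro the_equality) (auto simp: is_least_fp_def intro: antisym)

lemma is_least_fp_ex:
  fixes F :: "real^'n \<Rightarrow> real^'n"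
  assumes mono: "\<And>x y. 0 \<le> x \<Longrightarrow> x \<le> y \<Longrightarrow> y \<le> 1 \<Longrightarrow> F x \<le> F y"
    and nonneg: "\<And>x. 0 \<le> x \<Longrightarrow> x \<le> 1 \<Longrightarrow> 0 \<le> F x"
    and le1: "F 1 \<le> 1"
  shows "\<exists>x. is_least_fp F x"
proof -
  define S where "S = {x. 0 \<le> x \<and> x \<le> 1 \<and> F x \<le> x}"
  define z :: "real^'n" where "z = (\<chi> i. INF x\<in>S. x $ i)"
  have one: "1 \<in> S" using le1 by (auto simp: S_def less_eq_vec_def)
  have z_le: "z \<le> x" if "x \<in> S" for x
    unfolding less_eq_vec_def z_def
    using that by (auto intro!: cINF_lower bdd_belowI[where m=0] simp: S_def less_eq_vec_def)
  have z_ge: "y \<le> z" if "\<And>x. x \<in> S \<Longrightarrow> y \<le> x" for y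
    unfolding less_eq_vec_def z_def
    using that one by (auto intro!: cINF_greatest simp: less_eq_vec_def)
  have z0: "0 \<le> z" by (rule z_ge) (auto simp: S_def)
  have z1: "z \<le> 1" by (rule z_le[OF one])
  have Fz: "F z \<le> z"
  proof (rule z_ge)
    fix x assume x: "x \<in> S"
    have "F z \<le> F x" using mono[OF z0 z_le[OF x]] x by (auto simp: S_def)
    also have "F x \<le> x" using x by (auto simp: S_def)
    finally show "F z \<le> x" .
  qed
  have "F (F z) \<le> F z" using mono[OF nonneg[OF z0 z1] Fz z1] .
  hence "F z \<in> S" using nonneg[OF z0 z1] Fz z1 by (auto simp: S_def)
  hence "F z = z" using z_le Fz by (intro antisym) auto
  moreover have "z \<le> y" if "y \<in> {0..1}" "F y = y" for y
    using that by (intro z_le) (auto simp: S_def)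
  ultimately show ?thesis using z0 z1 unfolding is_least_fp_def by auto
qed

lemma eval_poly_nonneg:
  assumes "probabilistic_poly p" "0 \<le> x"
  shows "0 \<le> eval_poly p x"
  using assms unfolding eval_poly_def probabilistic_poly_def
  by (auto intro!: sum_nonneg mult_nonneg_nonneg prod_nonneg simp: less_eq_vec_def)

lemma eval_poly_mono:
  assumes "probabilistic_poly p" "0 \<le> x" "x \<le> y"
  shows "eval_poly p x \<le> eval_poly p y"
  using assms unfolding eval_poly_def probabilistic_poly_def
  by (auto intro!: sum_mono mult_left_mono prod_mono power_mono simp: less_eq_vec_def)

lemma eval_poly_one:
  assumes "probabilistic_poly p"
  shows "eval_poly p 1 \<le> 1"
proof -
  have "eval_poly p 1 = of_rat (\<Sum>m\<in>Poly_Mapping.keys p. Poly_Mapping.lookup p m)"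
    by (simp add: eval_poly_def of_rat_sum)
  also have "\<dots> \<le> of_rat 1"
    using assms unfolding probabilistic_poly_def by (subst of_rat_less_eq) auto
  finally show ?thesis by simp
qed

lemma extremum_image_mono:
  assumes "finite S" "S \<noteq> {}" "\<And>p. p \<in> S \<Longrightarrow> f p \<le> g p"
  shows "extremum opt (f ` S) \<le> extremum opt (g ` S)"
proof (cases opt)
  case Maximize
  have "f p \<le> Max (g ` S)" if "p \<in> S" for p
    using assms(1) assms(3)[OF that] that by (intro order_trans[OF assms(3)[OF that] Max_ge]) auto
  then show ?thesis using assms Maximize by auto
next
  case Minimize
  have "Min (f ` S) \<le> g p" if "p \<in> S" for p
    using assms(1) that by (intro order_trans[OF Min_le assms(3)[OF that]]) auto
  then show ?thesis using assms Minimize by auto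
qed

lemma extremum_const: "S \<noteq> {} \<Longrightarrow> extremum opt ((\<lambda>_. c) ` S) = c"
  by (cases opt) (simp_all add: image_constant_conv)

lemma is_least_fp_pps_map:
  assumes "is_pps Q"
  shows "is_least_fp (pps_map opt Q) (least_fp (pps_map opt Q))"
proof -
  have ne: "set (Q i) \<noteq> {}" for i using assms by (auto simp: is_pps_def)
  have pr: "p \<in> set (Q i) \<Longrightarrow> probabilistic_poly p" for p i using assms by (auto simp: is_pps_def)
  have "\<exists>x. is_least_fp (pps_map opt Q) x"
  proof (rule is_least_fp_ex)
    fix x y :: "real^'a" assume "0 \<le> x" "x \<le> y" "y \<le> 1"
    thus "pps_map opt Q x \<le> pps_map opt Q y"
      unfolding pps_map_def less_eq_vec_def[of "vec_lambda _"]
      using ne by (auto intro!: extremum_image_mono eval_poly_mono intro: pr)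
  next
    fix x :: "real^'a" assume "0 \<le> x" "x \<le> 1"
    show "0 \<le> pps_map opt Q x"
      unfolding pps_map_def less_eq_vec_def
    proof clarsimp
      fix i
      have "extremum opt ((\<lambda>_. 0) ` set (Q i)) \<le> extremum opt ((\<lambda>p. eval_poly p x) ` set (Q i))"
        by (rule extremum_image_mono) (use ne \<open>0 \<le> x\<close> in \<open>auto intro: eval_poly_nonneg pr\<close>)
      thus "0 \<le> extremum opt ((\<lambda>p. eval_poly p x) ` set (Q i))"
        by (simp add: extremum_const[OF ne])
    qed
  next
    show "pps_map opt Q 1 \<le> 1"
      unfolding pps_map_def less_eq_vec_def
    proof clarsimp
      fix i
      have "extremum opt ((\<lambda>p. eval_poly p 1) ` set (Q i)) \<le> extremum opt ((\<lambda>_. 1) ` set (Q i))"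
        by (rule extremum_image_mono) (use ne in \<open>auto intro: eval_poly_one pr\<close>)
      thus "extremum opt ((\<lambda>p. eval_poly p 1) ` set (Q i)) \<le> 1"
        by (simp add: extremum_const[OF ne])
    qed
  qed
  thus ?thesis using least_fp_eqI by metis
qed

lemma is_least_fp_policy_map:
  assumes "is_pps Q" "is_policy Q \<sigma>"
  shows "is_least_fp (policy_map Q \<sigma>) (least_fp (policy_map Q \<sigma>))"
proof -
  have "policy_map Q \<sigma> = pps_map Maximize (\<lambda>i. [Q i ! \<sigma> i])"
    by (auto simp: policy_map_def pps_map_def fun_eq_iff vec_eq_iff)
  moreover have "is_pps (\<lambda>i. [Q i ! \<sigma> i])"
    using assms nth_mem unfolding is_pps_def is_policy_def by fastforce
  ultimately show ?thesis using is_least_fp_pps_map by metis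
qed

lemma finite_eigenvalues: "finite (eigenvalues (A :: real^'n^'n))"
proof -
  define M where "M = (\<chi> i j. complex_of_real (A $ i $ j))"
  have "\<forall>l\<in>eigenvalues A. \<exists>v. v \<noteq> 0 \<and> M *v v = l *s v"
    by (simp add: eigenvalues_def M_def)
  then obtain f where f0: "\<And>l. l \<in> eigenvalues A \<Longrightarrow> f l \<noteq> 0"
    and f: "\<And>l. l \<in> eigenvalues A \<Longrightarrow> M *v f l = l *s f l"
    by (auto dest!: bchoice)
  have inj: "inj_on f (eigenvalues A)"
  proof (rule inj_onI)
    fix k l assume "k \<in> eigenvalues A" "l \<in> eigenvalues A" "f k = f l"
    thus "k = l" using f f0 by (metis vector_mul_rcancel)
  qed
  have lin: "(\<forall>l\<in>S. c l = 0)"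
    if "finite S" "S \<subseteq> eigenvalues A" "(\<Sum>l\<in>S. c l *s f l) = 0" for S c
    using that
  proof (induction S arbitrary: c rule: finite_induct)
    case empty
    then show ?case by simp
  next
    case (insert k S)
    have "0 = M *v (\<Sum>l\<in>insert k S. c l *s f l) - k *s (\<Sum>l\<in>insert k S. c l *s f l)"
      using insert.prems by simp
    also have "\<dots> = (\<Sum>l\<in>insert k S. c l *s (M *v f l)) - (\<Sum>l\<in>insert k S. k *s (c l *s f l))"
      by (simp only: vec.scale_sum_right vec.linear_sum[OF matrix_vector_mul_linear_gen] vec.linear_scale[OF matrix_vector_mul_linear_gen])
    also have "\<dots> = (\<Sum>l\<in>insert k S. (c l * (l - k)) *s f l)"
      unfolding sum_subtractf[symmetric] using insert.prems
      by (intro sum.cong) (auto simp: f subset_iff vec_eq_iff algebra_simps)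
    also have "\<dots> = (\<Sum>l\<in>S. (c l * (l - k)) *s f l)"
      using insert.hyps by simp
    finally have "\<forall>l\<in>S. c l * (l - k) = 0"
      using insert.IH[of "\<lambda>l. c l * (l - k)"] insert.prems by auto
    hence z: "\<forall>l\<in>S. c l = 0" using insert.hyps by auto
    hence "c k *s f k = 0" using insert.prems insert.hyps by simp
    thus ?case using z f0 insert.prems by (auto simp: vector_mul_eq_0)
  qed
  have "card S \<le> CARD('n)" if S: "S \<subseteq> eigenvalues A" "finite S" for S
  proof -
    have "vec.independent (f ` S)"
    proof (rule vec.independent_if_scalars_zero)
      show "finite (f ` S)" using S by simp
      fix u x assume h: "(\<Sum>x\<in>f ` S. u x *s x) = 0" "x \<in> f ` S"
      have "(\<Sum>l\<in>S. u (f l) *s f l) = 0"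
        using h(1) by (simp add: sum.reindex[OF inj_on_subset[OF inj S(1)]])
      from lin[OF S(2,1) this] h(2) show "u x = 0" by auto
    qed
    hence "card (f ` S) \<le> vec.dim (UNIV :: (complex^'n) set)"
      by (intro vec.independent_card_le_dim) auto
    thus ?thesis
      using card_image[OF inj_on_subset[OF inj S(1)]] by (simp add: card_cart_basis)
  qed
  thus ?thesis by (metis infinite_arbitrarily_large not_less_eq_eq order_refl)
qed

end

theory Submission
  imports Defs
begin

text \<open>Write \<open>y = q\<sigma>\<close>. The polynomials of a simple normal form have degree at most two, so
  \<open>P\<^sub>\<sigma> q* - P\<^sub>\<sigma> y = J (q* - y)\<close> holds exactly, with \<open>J\<close> the Jacobian at the midpoint. Since
  \<open>P\<^sub>\<sigma> y = y\<close>, this reads \<open>(I - J) (q* - y) = q* - P\<^sub>\<sigma> q*\<close>. The residual \<open>q* - P\<^sub>\<sigma> q*\<close> is at most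
  \<open>\<parallel>q* - q\<parallel>\<close> in every component: it vanishes for the forms L and Q, and for the form M the policy
  is optimal at \<open>q\<close> while \<open>q \<le> q*\<close>.

  If \<open>(I - J) x \<ge> 0\<close> but \<open>x\<close> has a negative component, then the negative part \<open>z\<close> of \<open>x\<close>
  satisfies \<open>0 \<noteq> z \<le> J z\<close>. Brouwer's theorem on the simplex slice \<open>{w \<ge> 0. \<Sum>w = 1, w \<le> J w}\<close>
  then gives an eigenvalue of \<open>J\<close> that is at least 1, contradicting \<open>\<rho>(J) < 1\<close>. Hence \<open>I - J\<close> is
  injective with a nonnegative inverse.\<close>

section \<open>Evaluation of the polynomials of a simple normal form\<close>

lemma eval_poly_add: "eval_poly (p + q) x = eval_poly p x + eval_poly q x"
  unfolding eval_poly_def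
  \<comment> \<open>Coefficients may cancel, so \<open>p + q\<close> can have fewer keys than
    \<open>p\<close> and \<open>q\<close> together. The sums still add up because each summand is
    additive in the coefficient and vanishes at coefficient 0.\<close>
  by (rule setsum_keys_plus_distrib) (auto simp: of_rat_add algebra_simps)

lemma eval_poly_zero: "eval_poly 0 x = 0"
  by (simp add: eval_poly_def)

lemma eval_poly_sum: "eval_poly (\<Sum>a\<in>A. p a) x = (\<Sum>a\<in>A. eval_poly (p a) x)"
  by (induction A rule: infinite_finite_induct) (auto simp: eval_poly_zero eval_poly_add)

lemma eval_poly_single:
  "eval_poly (Poly_Mapping.single m a) x = of_rat a * (\<Prod>j\<in>UNIV. (x $ j) ^ Poly_Mapping.lookup m j)"
  by (simp add: eval_poly_def)

lemma prod_power_lookup_single: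
  fixes x :: "real^'n::finite"
  shows "(\<Prod>j\<in>UNIV. (x $ j) ^ Poly_Mapping.lookup (Poly_Mapping.single k 1) j) = x $ k"
proof -
  have "(\<Prod>j\<in>UNIV. (x $ j) ^ Poly_Mapping.lookup (Poly_Mapping.single k 1) j)
      = (\<Prod>j\<in>UNIV. if j = k then x $ j else 1)"
    by (intro prod.cong) (auto simp: lookup_single when_def)
  then show ?thesis by simp
qed

lemma eval_poly_Const: "eval_poly (Const a) x = of_rat a"
  by (simp add: Const_def eval_poly_single)

lemma eval_poly_Var: "eval_poly (Var k) x = x $ k"
  unfolding Var_def by (simp only: eval_poly_single prod_power_lookup_single) simp

lemma eval_poly_Const_times_Var: "eval_poly (Const a * Var k) x = of_rat a * x $ k"
  unfolding Var_def Const_def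
  by (simp only: mult_single eval_poly_single add_0_left prod_power_lookup_single) simp

lemma eval_poly_Var_times_Var: "eval_poly (Var j * Var k) x = x $ j * x $ k"
  unfolding Var_def
  by (simp only: mult_single eval_poly_single lookup_add power_add prod.distrib
      prod_power_lookup_single) simp

section \<open>The derivative at a midpoint\<close>

text \<open>Once a policy has chosen, form M leaves a single variable and joins form L as an affine
  polynomial. Only the linear coefficients keep a sign, as the constant disappears on
  differentiation.\<close>

lemma simple_normal_form_poly_cases:
  assumes "simple_normal_form Q" "is_policy Q \<sigma>"
  obtains (affine) a0 a where "\<And>j. 0 \<le> a j"
      "\<And>x. eval_poly (Q i ! \<sigma> i) x = a0 + (\<Sum>j\<in>UNIV. a j * x $ j)"
  | (quadratic) j k where "\<And>x. eval_poly (Q i ! \<sigma> i) x = x $ j * x $ k"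
proof -
  have len: "\<sigma> i < length (Q i)" using assms(2) by (simp add: is_policy_def)
  consider "form_L (Q i)" | "form_Q (Q i)" | "form_M (Q i)"
    using assms(1) by (auto simp: simple_normal_form_def)
  then show thesis
  proof cases
    case 1
    then obtain a0 a where a: "\<And>j. 0 \<le> a j"
      and Q: "Q i = [Const a0 + (\<Sum>j\<in>UNIV. Const (a j) * Var j)]"
      by (auto simp: form_L_def)
    show thesis
    proof (rule affine)
      show "0 \<le> (of_rat (a j) :: real)" for j using a by simp
      show "eval_poly (Q i ! \<sigma> i) x = of_rat a0 + (\<Sum>j\<in>UNIV. of_rat (a j) * x $ j)" for x
        using len Q by (simp add: eval_poly_add eval_poly_sum eval_poly_Const eval_poly_Const_times_Var)
    qed
  next
    case 2
    then obtain j k where "Q i = [Var j * Var k]" by (auto simp: form_Q_def)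
    then show thesis using len by (intro quadratic[of j k]) (simp add: eval_poly_Var_times_Var)
  next
    case 3
    then obtain j k where "Q i = [Var j, Var k]" by (auto simp: form_M_def)
    then obtain l where Q: "Q i ! \<sigma> i = Var l"
      using len by (cases "\<sigma> i") auto
    show thesis
    proof (rule affine)
      show "0 \<le> (if j = l then 1 else 0 :: real)" for j by simp
      show "eval_poly (Q i ! \<sigma> i) x = 0 + (\<Sum>j\<in>UNIV. (if j = l then 1 else 0) * x $ j)" for x
        by (simp add: Q eval_poly_Var if_distrib[where f = "\<lambda>c. c * _"] cong: if_cong)
    qed
  qed
qed

text \<open>An affine map has a constant derivative. For a product, the cross terms of c_j (x_k -
  y_k) + (x_j - y_j) c_k cancel exactly when c is the midpoint. Positivity of \<open>D\<close> on
  the nonnegative orthant will become nonnegativity of the Jacobian.\<close>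

lemma policy_poly_midpoint_derivative:
  assumes "simple_normal_form Q" "is_policy Q \<sigma>" "0 \<le> x" "0 \<le> y"
  shows "\<exists>D. ((\<lambda>z. eval_poly (Q i ! \<sigma> i) z) has_derivative D) (at ((1/2) *\<^sub>R (x + y)))
    \<and> D (x - y) = eval_poly (Q i ! \<sigma> i) x - eval_poly (Q i ! \<sigma> i) y
    \<and> (\<forall>h\<ge>0. 0 \<le> D h)"
  using assms(1,2)
proof (cases rule: simple_normal_form_poly_cases[where i = i])
  case (affine a0 a)
  have "((\<lambda>z. a0 + (\<Sum>j\<in>UNIV. a j * z $ j)) has_derivative (\<lambda>h. \<Sum>j\<in>UNIV. a j * h $ j)) F" for F
    by (auto intro!: derivative_eq_intros bounded_linear_imp_has_derivative bounded_linear_vec_nth)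
  moreover have "(\<Sum>j\<in>UNIV. a j * (x - y) $ j) = (\<Sum>j\<in>UNIV. a j * x $ j) - (\<Sum>j\<in>UNIV. a j * y $ j)"
    by (simp add: algebra_simps sum_subtractf)
  moreover have "\<forall>h\<ge>0. 0 \<le> (\<Sum>j\<in>UNIV. a j * h $ j)"
    using affine(1) by (auto intro!: sum_nonneg simp: less_eq_vec_def)
  ultimately show ?thesis unfolding affine(2) by (intro exI conjI) (auto simp del: vector_minus_component)
next
  case (quadratic j k)
  define c where "c = (1/2) *\<^sub>R (x + y)"
  have c0: "0 \<le> c $ l" for l using assms(3,4) by (auto simp: c_def less_eq_vec_def)
  have "((\<lambda>z. z $ j * z $ k) has_derivative (\<lambda>h. c $ j * h $ k + h $ j * c $ k)) (at c)"
    by (intro has_derivative_mult bounded_linear_imp_has_derivative bounded_linear_vec_nth)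
  moreover have "c $ j * (x - y) $ k + (x - y) $ j * c $ k = x $ j * x $ k - y $ j * y $ k"
    by (simp add: c_def field_simps)
  moreover have "\<forall>h\<ge>0. 0 \<le> c $ j * h $ k + h $ j * c $ k"
    using c0 by (auto simp: less_eq_vec_def)
  ultimately show ?thesis unfolding quadratic c_def by blast
qed

lemma policy_map_jacobian_midpoint:
  assumes "simple_normal_form Q" "is_policy Q \<sigma>" "0 \<le> x" "0 \<le> y"
    and J: "J = jacobian (policy_map Q \<sigma>) (at ((1/2) *\<^sub>R (x + y)))"
  shows "J *v (x - y) = policy_map Q \<sigma> x - policy_map Q \<sigma> y"
    and "0 \<le> J $ i $ j"
proof -
  let ?c = "(1/2) *\<^sub>R (x + y)"
  have "\<forall>i. \<exists>D. ((\<lambda>z. eval_poly (Q i ! \<sigma> i) z) has_derivative D) (at ?c)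
    \<and> D (x - y) = eval_poly (Q i ! \<sigma> i) x - eval_poly (Q i ! \<sigma> i) y \<and> (\<forall>h\<ge>0. 0 \<le> D h)"
    using policy_poly_midpoint_derivative[OF assms(1-4)] by blast
  from choice[OF this] obtain D where D: "\<And>i. ((\<lambda>z. eval_poly (Q i ! \<sigma> i) z) has_derivative D i) (at ?c)"
    and eq: "\<And>i. D i (x - y) = eval_poly (Q i ! \<sigma> i) x - eval_poly (Q i ! \<sigma> i) y"
    and pos: "\<And>i h. 0 \<le> h \<Longrightarrow> 0 \<le> D i h"
    by blast
  have der: "(policy_map Q \<sigma> has_derivative (\<lambda>h. \<chi> i. D i h)) (at ?c)"
    unfolding has_derivative_componentwise_within[of "policy_map Q \<sigma>"]
    by (auto simp: Basis_vec_def inner_axis policy_map_def D)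
  \<comment> \<open>\<open>jacobian\<close> is defined through a choice of derivative;
    differentiability and uniqueness of the derivative identify it with the rows
    \<open>D i\<close>.\<close>
  then have "(policy_map Q \<sigma> has_derivative (\<lambda>h. J *v h)) (at ?c)"
    using jacobian_works J differentiableI by blast
  then have Jv: "J *v h = (\<chi> i. D i h)" for h
    using has_derivative_unique[OF der] by metis
  show "J *v (x - y) = policy_map Q \<sigma> x - policy_map Q \<sigma> y"
    by (simp add: Jv eq policy_map_def vec_eq_iff)
  have "J $ i $ j = (J *v axis j 1) $ i"
    by (simp add: matrix_vector_mult_basis column_def)
  also have "\<dots> \<ge> 0"
    using pos[of "axis j 1" i] by (simp add: Jv less_eq_vec_def axis_def)
  finally show "0 \<le> J $ i $ j" .
qed

section \<open>Nonnegative matrices of spectral radius less than one\<close>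

lemma of_real_eigenvalue:
  fixes A :: "real^'n^'n"
  assumes "A *v w = l *s w" "w \<noteq> 0"
  shows "complex_of_real l \<in> eigenvalues A"
proof -
  define v :: "complex^'n" where "v = (\<chi> i. complex_of_real (w $ i))"
  have "v \<noteq> 0" using assms(2) by (auto simp: v_def vec_eq_iff)
  moreover have "(\<chi> i j. complex_of_real (A $ i $ j)) *v v = complex_of_real l *s v"
  proof -
    have "(\<Sum>j\<in>UNIV. A $ i $ j * w $ j) = l * w $ i" for i
      using assms(1) by (simp add: vec_eq_iff matrix_vector_mult_def)
    then have "complex_of_real (\<Sum>j\<in>UNIV. A $ i $ j * w $ j) = complex_of_real (l * w $ i)" for i
      by simp
    then show ?thesis
      by (simp add: vec_eq_iff matrix_vector_mult_def v_def)
  qed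
  ultimately show ?thesis unfolding eigenvalues_def by blast
qed

lemma nonneg_matrix_vector_mult_mono:
  fixes A :: "real^'n^'m"
  assumes "\<And>i j. 0 \<le> A $ i $ j" "x \<le> y"
  shows "A *v x \<le> A *v y"
  using assms by (auto simp: less_eq_vec_def matrix_vector_mult_def intro!: sum_mono mult_left_mono)

text \<open>A Perron-Frobenius argument: a fixed point of the normalised map w -> A w / s(A w) is an
  eigenvector whose eigenvalue is the normalising factor.\<close>

lemma spectral_radius_ge_1:
  fixes A :: "real^'n^'n"
  assumes nonneg: "\<And>i j. 0 \<le> A $ i $ j"
    and z: "0 \<le> z" "z \<noteq> 0" "z \<le> A *v z"
  shows "1 \<le> spectral_radius A"
proof -
  define s :: "real^'n \<Rightarrow> real" where "s x = (\<Sum>i\<in>UNIV. x $ i)" for x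
  \<comment> \<open>Keeping \<open>w \<le> A *v w\<close> in \<open>S\<close> bounds the coordinate
    sum of \<open>A *v w\<close> below by 1, so that \<open>f\<close> never divides by zero and the
    eigenvalue found is at least 1.\<close>
  define S where "S = {w. 0 \<le> w \<and> s w = 1 \<and> w \<le> A *v w}"
  define f where "f w = inverse (s (A *v w)) *\<^sub>R (A *v w)" for w
  have s_scale: "s (c *\<^sub>R x) = c * s x" for c x
    by (simp add: s_def sum_distrib_left)
  have s_add: "s (x + y) = s x + s y" for x y
    by (simp add: s_def sum.distrib)
  have s_mono: "s x \<le> s y" if "x \<le> y" for x y
    using that by (auto simp: s_def less_eq_vec_def intro: sum_mono)
  have s_ge1: "1 \<le> s (A *v w)" if "w \<in> S" for w
    using that s_mono[of w "A *v w"] by (simp add: S_def)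
  have cont_s: "continuous_on T (\<lambda>x. s (g x))" if "continuous_on T g" for T and g :: "real^'n \<Rightarrow> real^'n"
    unfolding s_def by (intro continuous_intros that)
  have cont_A: "continuous_on T (\<lambda>x. A *v x)" for T
    by (intro linear_continuous_on matrix_vector_mul_bounded_linear)
  have S_alt: "S = (\<Inter>i. {w. 0 \<le> w $ i}) \<inter> {w. s w = 1} \<inter> (\<Inter>i. {w. w $ i \<le> (A *v w) $ i})"
    by (auto simp: S_def less_eq_vec_def)
  have "closed {w :: real^'n. 0 \<le> w $ i}" for i
    by (intro closed_Collect_le continuous_on_const continuous_on_component continuous_on_id)
  moreover have "closed {w. w $ i \<le> (A *v w) $ i}" for i
    by (intro closed_Collect_le continuous_on_component continuous_on_id cont_A)
  moreover have "closed {w. s w = 1}"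
    using continuous_on_id by (intro closed_Collect_eq continuous_on_const cont_s) simp
  ultimately have "closed S"
    unfolding S_alt by (intro closed_Int closed_INT ballI)
  moreover have "S \<subseteq> {0..1}"
  proof
    fix w assume w: "w \<in> S"
    have "w $ i \<le> s w" for i
      unfolding s_def using w by (intro member_le_sum) (auto simp: S_def less_eq_vec_def)
    then show "w \<in> {0..1}" using w by (auto simp: S_def less_eq_vec_def)
  qed
  then have "bounded S"
    by (rule bounded_subset[rotated]) (simp add: interval_cbox_cart)
  ultimately have "compact S" by (simp add: compact_eq_bounded_closed)
  have sz: "0 < s z"
  proof -
    obtain i where "z $ i \<noteq> 0" using z(2) by (auto simp: vec_eq_iff)
    then show ?thesis
      using z(1) unfolding s_def
      by (intro sum_pos2[where i = i]) (auto simp: less_eq_vec_def order.strict_iff_order)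
  qed
  have scale_le: "c *\<^sub>R x \<le> c *\<^sub>R y" if "x \<le> y" "0 \<le> c" for c and x y :: "real^'n"
    using that by (auto simp: less_eq_vec_def intro: mult_left_mono)
  have "inverse (s z) *\<^sub>R z \<in> S"
    using sz z scale_le[of 0 z "inverse (s z)"] scale_le[of z "A *v z" "inverse (s z)"]
    by (simp add: S_def s_scale matrix_vector_mult_scaleR)
  then have ne: "S \<noteq> {}" by blast
  have "convex S"
  proof (rule convexI)
    fix x y u v assume h: "x \<in> S" "y \<in> S" "0 \<le> (u::real)" "0 \<le> v" "u + v = 1"
    have "u *\<^sub>R x + v *\<^sub>R y \<le> u *\<^sub>R (A *v x) + v *\<^sub>R (A *v y)"
      using h by (intro add_mono scale_le) (auto simp: S_def)
    moreover have "0 \<le> u *\<^sub>R x + v *\<^sub>R y"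
      using h by (auto simp: S_def less_eq_vec_def)
    ultimately show "u *\<^sub>R x + v *\<^sub>R y \<in> S"
      using h by (simp add: S_def s_add s_scale matrix_vector_mult_scaleR matrix_vector_right_distrib)
  qed
  have "continuous_on S f"
    unfolding f_def using s_ge1
    by (intro continuous_intros cont_s cont_A) force
  moreover have "f \<in> S \<rightarrow> S"
  proof
    fix w assume w: "w \<in> S"
    define c where "c = inverse (s (A *v w))"
    have c: "0 < c" "c * s (A *v w) = 1" using s_ge1[OF w] by (auto simp: c_def)
    have "0 \<le> A *v w" using w by (auto simp: S_def)
    \<comment> \<open>The defining inequality of \<open>S\<close> survives an application of the
      monotone map \<open>A\<close>, and then the positive rescaling.\<close>
    moreover have "A *v w \<le> A *v (A *v w)"
      using w by (intro nonneg_matrix_vector_mult_mono nonneg) (simp add: S_def)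
    ultimately have "0 \<le> c *\<^sub>R (A *v w)" "c *\<^sub>R (A *v w) \<le> c *\<^sub>R (A *v (A *v w))"
      using scale_le[of 0 "A *v w" c] scale_le[of _ _ c] c(1) by auto
    then show "f w \<in> S"
      using c by (simp add: f_def S_def s_scale matrix_vector_mult_scaleR flip: c_def)
  qed
  ultimately obtain w where w: "w \<in> S" "f w = w"
    using brouwer[OF \<open>compact S\<close> \<open>convex S\<close> ne] by blast
  define l where "l = s (A *v w)"
  have l: "1 \<le> l" using s_ge1[OF w(1)] by (simp add: l_def)
  have "A *v w = l *\<^sub>R f w" using l by (simp add: f_def l_def)
  then have "A *v w = l *s w" using w(2) by (simp add: scalar_mult_eq_scaleR)
  moreover have "w \<noteq> 0" using w(1) by (auto simp: S_def s_def)
  ultimately have "complex_of_real l \<in> eigenvalues A" by (rule of_real_eigenvalue)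
  \<comment> \<open>\<open>Max\<close> is meaningful here because a matrix has only finitely many
    eigenvalues.\<close>
  then have "cmod (complex_of_real l) \<le> spectral_radius A"
    unfolding spectral_radius_def by (intro Max_ge imageI) (simp_all add: finite_eigenvalues)
  then show ?thesis using l by simp
qed

lemma mat_1_minus_inverse_positive:
  fixes A :: "real^'n^'n"
  assumes nonneg: "\<And>i j. 0 \<le> A $ i $ j" and rho: "spectral_radius A < 1"
    and x: "0 \<le> (mat 1 - A) *v x"
  shows "0 \<le> x"
proof (rule ccontr)
  assume neg: "\<not> 0 \<le> x"
  define z :: "real^'n" where "z = (\<chi> i. max 0 (- x $ i))"
  have z0: "0 \<le> z" by (simp add: z_def less_eq_vec_def)
  have "- x \<le> z" by (simp add: z_def less_eq_vec_def)
  then have "A *v (- x) \<le> A *v z"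
    using nonneg by (intro nonneg_matrix_vector_mult_mono)
  moreover have "A *v (- x) = - (A *v x)"
    by (simp add: vec_eq_iff matrix_vector_mult_def sum_negf)
  then have "- x \<le> A *v (- x)"
    using x by (simp add: matrix_vector_mult_diff_rdistrib)
  ultimately have "- x \<le> A *v z" by (rule order_trans[rotated])
  moreover have "0 \<le> A *v z"
    using nonneg_matrix_vector_mult_mono[OF nonneg z0] by simp
  \<comment> \<open>Each component of \<open>z\<close> is the larger of 0 and that of
    \<open>- x\<close>, and both vectors lie below \<open>A *v z\<close>.\<close>
  ultimately have "z \<le> A *v z" by (simp add: less_eq_vec_def z_def)
  moreover have "z \<noteq> 0"
  proof -
    obtain i where "x $ i < 0" using neg by (auto simp: less_eq_vec_def not_le)
    then have "z $ i \<noteq> 0" by (simp add: z_def)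
    then show ?thesis by auto
  qed
  ultimately show False
    using spectral_radius_ge_1[OF nonneg z0] rho by fastforce
qed

lemma matrix_inv_cancel:
  fixes A :: "'a::semiring_1^'n^'m"
  assumes "invertible A"
  shows "A ** matrix_inv A = mat 1" "matrix_inv A ** A = mat 1"
  using someI_ex[OF assms[unfolded invertible_def]] by (simp_all add: matrix_inv_def)

text \<open>Inverse positivity applied to a kernel vector and to its negative forces it to be 0.
  Column j of the inverse is mapped by I - A to the nonnegative basis vector
  \<open>axis j 1\<close>, so it is nonnegative as well.\<close>

lemma invertible_mat_1_minus:
  fixes A :: "real^'n^'n"
  assumes nonneg: "\<And>i j. 0 \<le> A $ i $ j" and rho: "spectral_radius A < 1"
  shows "invertible (mat 1 - A)" "0 \<le> matrix_inv (mat 1 - A) $ i $ j"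
proof -
  have "x = 0" if "(mat 1 - A) *v x = 0" for x
  proof (rule antisym)
    show "0 \<le> x" by (rule mat_1_minus_inverse_positive[OF nonneg rho]) (simp add: that)
    have "(mat 1 - A) *v (- x) = 0"
      using that by (simp add: matrix_vector_mult_def vec_eq_iff sum_negf)
    then have "0 \<le> - x" using mat_1_minus_inverse_positive[OF nonneg rho, of "- x"] by simp
    then show "x \<le> 0" by simp
  qed
  then show inv: "invertible (mat 1 - A)"
    unfolding invertible_left_inverse matrix_left_invertible_ker by simp
  have "(mat 1 - A) *v (matrix_inv (mat 1 - A) *v axis j 1) = axis j 1"
    by (simp add: matrix_vector_mul_assoc matrix_inv_cancel[OF inv])
  moreover have "(0 :: real^'n) \<le> axis j 1" by (simp add: less_eq_vec_def axis_def)
  ultimately have "0 \<le> matrix_inv (mat 1 - A) *v axis j 1"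
    using mat_1_minus_inverse_positive[OF nonneg rho] by metis
  then show "0 \<le> matrix_inv (mat 1 - A) $ i $ j"
    by (simp add: less_eq_vec_def matrix_vector_mult_basis column_def)
qed

section \<open>The error bound\<close>

lemma infnorm_le_cart:
  fixes x :: "real^'n"
  assumes "\<And>i. \<bar>x $ i\<bar> \<le> b"
  shows "infnorm x \<le> b"
  unfolding infnorm_cart using assms by (intro cSup_least) auto

lemma row_sum_le_mat_infnorm: "(\<Sum>j\<in>UNIV. \<bar>A $ i $ j\<bar>) \<le> mat_infnorm A"
  unfolding mat_infnorm_def by (intro Max_ge) auto

lemma mat_infnorm_nonneg: "0 \<le> mat_infnorm A"
  by (rule order_trans[OF sum_nonneg row_sum_le_mat_infnorm]) simp

lemma infnorm_matrix_vector_mult_le: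
  fixes A :: "real^'n^'m"
  shows "infnorm (A *v x) \<le> mat_infnorm A * infnorm x"
proof (rule infnorm_le_cart)
  fix i
  have "\<bar>(A *v x) $ i\<bar> \<le> (\<Sum>j\<in>UNIV. \<bar>A $ i $ j\<bar> * \<bar>x $ j\<bar>)"
    by (simp add: matrix_vector_mult_def flip: abs_mult)
  also have "\<dots> \<le> (\<Sum>j\<in>UNIV. \<bar>A $ i $ j\<bar>) * infnorm x"
    by (auto simp: sum_distrib_right intro!: sum_mono mult_left_mono component_le_infnorm_cart)
  also have "\<dots> \<le> mat_infnorm A * infnorm x"
    by (intro mult_right_mono row_sum_le_mat_infnorm infnorm_pos_le)
  finally show "\<bar>(A *v x) $ i\<bar> \<le> mat_infnorm A * infnorm x" .
qed

lemma policy_residual_le: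
  fixes Q :: "'n::finite pps"
  assumes "simple_normal_form Q" "is_policy Q \<sigma>"
    and opt_at: "pps_map opt Q q = policy_map Q \<sigma> q" and "q \<le> x"
  shows "infnorm (pps_map opt Q x - policy_map Q \<sigma> x) \<le> infnorm (x - q)"
proof (rule infnorm_le_cart)
  fix i
  have len: "\<sigma> i < length (Q i)" using assms(2) by (simp add: is_policy_def)
  have at: "extremum opt ((\<lambda>p. eval_poly p q) ` set (Q i)) = eval_poly (Q i ! \<sigma> i) q"
    using opt_at by (simp add: pps_map_def policy_map_def vec_eq_iff)
  have "\<bar>extremum opt ((\<lambda>p. eval_poly p x) ` set (Q i)) - eval_poly (Q i ! \<sigma> i) x\<bar> \<le> infnorm (x - q)"
  proof (cases "form_M (Q i)")
    case True
    then obtain j k where Q: "Q i = [Var j, Var k]" by (auto simp: form_M_def)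
    then have choice: "Q i ! \<sigma> i = Var j \<or> Q i ! \<sigma> i = Var k"
      using len by (cases "\<sigma> i") auto
    have bounds: "q $ l \<le> x $ l" "x $ l - q $ l \<le> infnorm (x - q)" for l
      using component_le_infnorm_cart[of "x - q" l] \<open>q \<le> x\<close> by (auto simp: less_eq_vec_def)
    \<comment> \<open>Here l is the choice of the policy. With b the norm of x - q, the other
      variable satisfies x_m <= q_m + b <= q_l + b <= x_l + b.\<close>
    have max: "\<bar>max (x $ l) (x $ m) - x $ l\<bar> \<le> infnorm (x - q)" if "max (q $ l) (q $ m) = q $ l" for l m
      using that bounds(1)[of l] bounds(1)[of m] bounds(2)[of l] bounds(2)[of m] by linarith
    \<comment> \<open>Dually, x_l <= q_l + b <= q_m + b <= x_m + b.\<close>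
    have min: "\<bar>min (x $ l) (x $ m) - x $ l\<bar> \<le> infnorm (x - q)" if "min (q $ l) (q $ m) = q $ l" for l m
      using that bounds(1)[of l] bounds(1)[of m] bounds(2)[of l] bounds(2)[of m] by linarith
    show ?thesis
    proof (cases opt)
      case Maximize
      from choice show ?thesis
      proof
        assume "Q i ! \<sigma> i = Var j"
        then show ?thesis
          using at max[of j k] by (simp add: Maximize Q eval_poly_Var)
      next
        assume "Q i ! \<sigma> i = Var k"
        then show ?thesis
          using at max[of k j] by (simp add: Maximize Q eval_poly_Var max.commute)
      qed
    next
      case Minimize
      from choice show ?thesis
      proof
        assume "Q i ! \<sigma> i = Var j"
        then show ?thesis
          using at min[of j k] by (simp add: Minimize Q eval_poly_Var)
      next
        assume "Q i ! \<sigma> i = Var k"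
        then show ?thesis
          using at min[of k j] by (simp add: Minimize Q eval_poly_Var min.commute)
      qed
    qed
  next
    case False
    then obtain p where Q: "Q i = [p]"
      using assms(1) by (auto simp: simple_normal_form_def form_L_def form_Q_def)
    \<comment> \<open>With a single polynomial there is nothing to choose, and the residual is
      0.\<close>
    then show ?thesis using len by (cases opt) (auto simp: infnorm_pos_le)
  qed
  then show "\<bar>(pps_map opt Q x - policy_map Q \<sigma> x) $ i\<bar> \<le> infnorm (x - q)"
    by (simp add: pps_map_def policy_map_def)
qed

theorem theorem4p3:
  fixes opt :: objective
    and Q :: "'n::finite pps"
    and \<sigma> :: "'n \<Rightarrow> nat"
    and q qs q\<sigma> :: "real^'n"
    and J :: "real^'n^'n"
  assumes "is_pps Q" and "simple_normal_form Q"
    and "qs = least_fp (pps_map opt Q)"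
    and "0 \<le> q" and "q \<le> qs" and "\<forall>i. q $ i < 1"
    and "is_policy Q \<sigma>" and "pps_map opt Q q = policy_map Q \<sigma> q"
    and "q\<sigma> = least_fp (policy_map Q \<sigma>)"
    and "J = jacobian (policy_map Q \<sigma>) (at ((1/2) *\<^sub>R (qs + q\<sigma>)))"
    and "spectral_radius J < 1"
  shows "invertible (mat 1 - J)
    \<and> (\<forall>i j. 0 \<le> matrix_inv (mat 1 - J) $ i $ j)
    \<and> infnorm (q\<sigma> - qs) \<le> (2 * mat_infnorm (matrix_inv (mat 1 - J)) + 1) * infnorm (qs - q)"
proof -
  have qs: "0 \<le> qs" "pps_map opt Q qs = qs"
    using is_least_fp_pps_map[OF assms(1), of opt] assms(3) by (auto simp: is_least_fp_def)
  have q\<sigma>: "0 \<le> q\<sigma>" "policy_map Q \<sigma> q\<sigma> = q\<sigma>"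
    using is_least_fp_policy_map[OF assms(1) assms(7)] assms(9) by (auto simp: is_least_fp_def)
  note mid = policy_map_jacobian_midpoint[OF assms(2) assms(7) qs(1) q\<sigma>(1) assms(10)]
  note inv = invertible_mat_1_minus[OF mid(2) assms(11)]
  define N where "N = matrix_inv (mat 1 - J)"
  \<comment> \<open>The midpoint identity turns \<open>J *v (qs - q\<sigma>)\<close> into the
    difference of the policy map at the two points, and \<open>q\<sigma>\<close> cancels as its
    fixed point.\<close>
  have "(mat 1 - J) *v (qs - q\<sigma>) = qs - policy_map Q \<sigma> qs"
    by (simp add: matrix_vector_mult_diff_rdistrib mid(1) q\<sigma>(2))
  then have "qs - q\<sigma> = N *v (qs - policy_map Q \<sigma> qs)"
    by (metis N_def matrix_inv_cancel(2)[OF inv(1)] matrix_vector_mul_assoc matrix_vector_mul_lid)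
  then have "infnorm (q\<sigma> - qs) \<le> mat_infnorm N * infnorm (qs - policy_map Q \<sigma> qs)"
    by (metis infnorm_sub infnorm_matrix_vector_mult_le)
  also have "\<dots> \<le> mat_infnorm N * infnorm (qs - q)"
    \<comment> \<open>Since \<open>qs\<close> is fixed by the max/min map, the residual bound at
      \<open>qs\<close> concerns \<open>qs\<close> minus its image under the policy map.\<close>
    using policy_residual_le[OF assms(2,7,8,5)] by (simp add: qs(2) mult_left_mono mat_infnorm_nonneg)
  also have "\<dots> \<le> (2 * mat_infnorm N + 1) * infnorm (qs - q)"
    using mat_infnorm_nonneg[of N] by (intro mult_right_mono infnorm_pos_le) simp
  finally show ?thesis using inv by (simp add: N_def)
qed

end
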